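(* Let $d\ge 1$, $\Omega=\{1,2,\dots,d\}^{\mathbb N}$, and let $G\subset\Omega\times\Omega$ be the groupoid of the "bigger than two" relation, with the transverse function $\nu$ given by the counting measure on each class. Let $k\ge 1$ and suppose that $\varphi:\Omega\to\mathbb R$ depends only on the first $k$ coordinates, i.e. $\varphi(x_1,\dots,x_k,x_{k+1},\dots)=\varphi(x_1,\dots,x_k)$. Let $\mu$ be a Borel probability on $\Omega$ with $\mathcal L_{-\varphi}^*(\mu)=\lambda\mu$ for some $\lambda>0$. Then $\mu$ satisfies the $(c,1)$-KMS condition for $(G,\nu)$, where $c(x,y)=\varphi(y)-\varphi(x)$. That is, for all $h\in I(G,\nu)$, $$\int\sum_{j=1}^d h\big((j,x_2,x_3,\dots),(x_1,x_2,x_3,\dots)\big)\,d\mu(x)=\int\sum_{j=1}^d h\big((x_1,x_2,x_3,\dots),(j,x_2,x_3,\dots)\big)\,e^{-\varphi(j,x_2,x_3,\dots)+\varphi(x_1,x_2,x_3,\dots)}\,d\mu(x).$$ The same holds with $\beta c$ in place of $c$ for $\beta>0$: if $\mu$ is a Borel probability with $\mathcal L_{-\beta\varphi}^*(\mu)=\lambda\mu$ for some $\lambda>0$, then $\mu$ satisfies the $(c,\beta)$-KMS condition for $(G,\nu)$.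
   Context: $\Omega=\{1,\dots,d\}^{\mathbb N}$ has the product topology; points are written $x=(x_1,x_2,x_3,\dots)$. The bigger than two relation is: $x\sim y$ iff $x_j=y_j$ for all $j\ge 2$; so the class of $x$ is $\{(j,x_2,x_3,\dots): j=1,\dots,d\}$. $G=\{(x,y)\in\Omega\times\Omega: x\sim y\}$ with the Borel $\sigma$-algebra induced from $\Omega\times\Omega$. For each $x$, $\nu^x$ is the counting measure on the class of $x$. $I(G,\nu)$ is the set of Borel functions $h:G\to\mathbb C$ with $\max\{\sup_y\int|h(x,y)|\,\nu^y(dx),\ \sup_y\int|h(y,x)|\,\nu^y(dx)\}<\infty$. For a function $c:G\to\mathbb R$ with $c(x,y)+c(y,z)=c(x,z)$ (a cocycle) and $\beta\in\mathbb R$, a probability $M$ on $\Omega$ satisfies the $(c,\beta)$-KMS condition for $(G,\nu)$ if for every $h\in I(G,\nu)$ $$\int\int h(s,x)\,\nu^x(ds)\,dM(x)=\int\int h(x,s)\,e^{-\beta c(x,s)}\,\nu^x(ds)\,dM(x).$$ For a potential $A:\Omega\to\mathbb R$ the Ruelle operator acts on continuous $v:\Omega\to\mathbb R$ by $\mathcal L_A(v)(x_1,x_2,\dots)=\sum_{a=1}^d e^{A(a,x_1,x_2,\dots)}v(a,x_1,x_2,\dots)$, and $\mathcal L_A^*$ is its dual acting on measures: $\int v\,d\mathcal L_A^*(\mu)=\int\mathcal L_A(v)\,d\mu$. *)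

theory Defs
  imports "HOL-Probability.Probability"
begin

(* A point (x_1, x_2, x_3, ...) is encoded with indices starting at 0: x n is the coordinate
   x_(n+1).  The library topology on nat => nat is the product of the discrete topologies, so
   its trace on Omega d is the product topology of {1..d}^N. *)

type_synonym point = "nat \<Rightarrow> nat"

definition Omega :: "nat \<Rightarrow> point set" where
  "Omega d = {x. \<forall>n. x n \<in> {1..d}}"

definition borel_Omega :: "nat \<Rightarrow> point measure" where
  "borel_Omega d = restrict_space borel (Omega d)"

definition borel_probability :: "nat \<Rightarrow> point measure \<Rightarrow> bool" where
  "borel_probability d M \<longleftrightarrow> sets M = sets (borel_Omega d) \<and> prob_space M"

definition bigger_than_two :: "point \<Rightarrow> point \<Rightarrow> bool" where
  "bigger_than_two x y \<longleftrightarrow> (\<forall>n\<ge>1. x n = y n)"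

definition groupoid :: "nat \<Rightarrow> (point \<times> point) set" where
  "groupoid d = {(x, y) \<in> Omega d \<times> Omega d. bigger_than_two x y}"

definition class_of :: "nat \<Rightarrow> point \<Rightarrow> point set" where
  "class_of d x = {y \<in> Omega d. bigger_than_two x y}"

(* Classes are finite, so each of their subsets is Borel and the discrete sigma-algebra of
   count_space is the trace of the Borel one. *)
definition nu :: "nat \<Rightarrow> point \<Rightarrow> point measure" where
  "nu d x = count_space (class_of d x)"

(* Functions on the groupoid are total functions of which only the restriction to the groupoid
   is ever used. *)
definition I_space :: "nat \<Rightarrow> (point \<times> point \<Rightarrow> complex) set" where
  "I_space d = {h. h \<in> borel_measurable (restrict_space borel (groupoid d)) \<and>
     max (SUP y\<in>Omega d. \<integral>\<^sup>+ x. ennreal (norm (h (x, y))) \<partial>nu d y)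
         (SUP y\<in>Omega d. \<integral>\<^sup>+ x. ennreal (norm (h (y, x))) \<partial>nu d y) < \<infinity>}"

definition cocycle :: "nat \<Rightarrow> (point \<times> point \<Rightarrow> real) \<Rightarrow> bool" where
  "cocycle d c \<longleftrightarrow>
     (\<forall>x y z. (x, y) \<in> groupoid d \<longrightarrow> (y, z) \<in> groupoid d \<longrightarrow> c (x, y) + c (y, z) = c (x, z))"

(* The integrability clauses say that both sides of the identity exist: without them a
   non-integrable side would silently count as 0. *)
definition KMS :: "nat \<Rightarrow> (point \<times> point \<Rightarrow> real) \<Rightarrow> real \<Rightarrow> point measure \<Rightarrow> bool" where
  "KMS d c \<beta> M \<longleftrightarrow> cocycle d c \<and> borel_probability d M \<and>
     (\<forall>h\<in>I_space d.
        integrable M (\<lambda>x. \<integral>s. h (s, x) \<partial>nu d x) \<and>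
        integrable M (\<lambda>x. \<integral>s. h (x, s) * complex_of_real (exp (- \<beta> * c (x, s))) \<partial>nu d x) \<and>
        (\<integral>x. (\<integral>s. h (s, x) \<partial>nu d x) \<partial>M) =
        (\<integral>x. (\<integral>s. h (x, s) * complex_of_real (exp (- \<beta> * c (x, s))) \<partial>nu d x) \<partial>M))"

(* case_nat a x is the sequence (a, x_1, x_2, ...). *)
definition ruelle :: "nat \<Rightarrow> (point \<Rightarrow> real) \<Rightarrow> (point \<Rightarrow> real) \<Rightarrow> point \<Rightarrow> real" where
  "ruelle d A v x = (\<Sum>a=1..d. exp (A (case_nat a x)) * v (case_nat a x))"

(* ruelle_dual d A mu rho says that rho is the image of mu under the dual of the Ruelle operator.
   A finite Borel measure on the compact metrizable space Omega d is determined by its integrals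
   of continuous functions, so there is at most one such rho. *)
definition ruelle_dual ::
  "nat \<Rightarrow> (point \<Rightarrow> real) \<Rightarrow> point measure \<Rightarrow> point measure \<Rightarrow> bool" where
  "ruelle_dual d A \<mu> \<rho> \<longleftrightarrow> sets \<rho> = sets (borel_Omega d) \<and> finite_measure \<rho> \<and>
     (\<forall>v. continuous_on (Omega d) v \<longrightarrow> (\<integral>x. v x \<partial>\<rho>) = (\<integral>x. ruelle d A v x \<partial>\<mu>))"

definition depends_on_first :: "nat \<Rightarrow> nat \<Rightarrow> (point \<Rightarrow> real) \<Rightarrow> bool" where
  "depends_on_first d k \<phi> \<longleftrightarrow>
     (\<forall>x\<in>Omega d. \<forall>y\<in>Omega d. (\<forall>n<k. x n = y n) \<longrightarrow> \<phi> x = \<phi> y)"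

end

theory Submission
  imports Defs
begin

text \<open>
  Write \<open>A = - \<beta> \<phi>\<close>. The eigenmeasure equation says that
  \<open>r \<integral> f d\<mu> = \<integral> (\<Sum>a. exp (A(ax)) f(ax)) d\<mu>(x)\<close>, where \<open>ax\<close> is the sequence \<open>x\<close> with the symbol \<open>a\<close>
  put in front of it. The points \<open>1x, ..., dx\<close> form exactly one class of the relation, so the right-hand
  side is an integral over classes of weighted sums over the points of the class. For \<open>f\<close> one inserts
  the two sides of the KMS identity,
  \<open>F(x) = \<Sum>j. h(j\<sigma>x, x)\<close> and \<open>H(x) = \<Sum>j. h(x, j\<sigma>x) exp (A(j\<sigma>x) - A(x))\<close>, where \<open>\<sigma>\<close> is the shift.
  Since \<open>\<sigma>(ax) = x\<close>, the integrands become the double sums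
  \<open>\<Sum>a. \<Sum>j. exp (A(ax)) h(jx, ax)\<close> and \<open>\<Sum>a. \<Sum>j. exp (A(jx)) h(ax, jx)\<close>: the factor \<open>exp (- A(ax))\<close> in
  \<open>H\<close> cancels the weight of the Ruelle operator. They differ only by the names of the two summation
  indices, hence \<open>r \<integral> F d\<mu> = r \<integral> H d\<mu>\<close>, and \<open>r > 0\<close> can be cancelled
  (\<open>eigenmeasure_exchange\<close>).

  The difficulty is that the eigenmeasure equation is given for continuous \<open>f\<close> only, whereas \<open>F\<close> and \<open>H\<close>
  are bounded Borel functions. To extend it, the measure \<open>ruelle_image d A \<mu>\<close> is constructed explicitly
  as a push-forward under \<open>(a, x) \<mapsto> ax\<close>, so that Fubini gives the formula for its integrals of
  all bounded Borel functions (\<open>integral_ruelle_image\<close>). A finite Borel measure on sequences is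
  determined by its integrals of continuous functions (\<open>finite_measure_eqI_continuous\<close>), so that
  this measure is \<open>r\<mu>\<close> (\<open>eigenmeasure_integral\<close>).

  The potential is a bounded continuous function: depending on finitely many coordinates, it is
  locally constant, hence continuous, and bounded because the space is compact. Functions \<open>h\<close> in
  \<open>I(G, \<nu>)\<close> are bounded because every single value is dominated by a sum over its class
  (\<open>I_space_bounded\<close>). Boundedness gives the integrability of both sides.
\<close>

section \<open>The space of sequences\<close>

lemma Omega_eq_PiE: "Omega d = (\<Pi>\<^sub>E n\<in>UNIV. {1..d})"
  by (auto simp: Omega_def PiE_def)

text \<open>
  Tychonoff's theorem for the product of copies of the finite set \<open>{1..d}\<close>.
\<close>

lemma compact_Omega: "compact (Omega d)"
proof -
  have "compactin (product_topology (\<lambda>_. euclidean) UNIV) (\<Pi>\<^sub>E n\<in>(UNIV::nat set). {1..d})"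
    unfolding compactin_PiE by (auto simp: compactin_euclidean_iff finite_imp_compact)
  then show ?thesis
    unfolding Omega_eq_PiE euclidean_product_topology compactin_euclidean_iff .
qed

lemma space_borel_Omega: "space (borel_Omega d) = Omega d"
  by (simp add: borel_Omega_def space_restrict_space)

lemma space_eq_Omega: "sets M = sets (borel_Omega d) \<Longrightarrow> space M = Omega d"
  by (simp add: space_borel_Omega cong: sets_eq_imp_space_eq)

lemma continuous_on_coordinate: "continuous_on S (\<lambda>x::point. x n)"
  by (rule continuous_on_subset[OF continuous_on_product_coordinates]) simp

lemma Omega_borel: "Omega d \<in> sets borel"
proof -
  have "Omega d = (\<Inter>n. (\<lambda>x. x n) -` {1..d})"
    by (auto simp: Omega_def)
  also have "closed \<dots>"
    unfolding closed_def vimage_Compl[symmetric] Compl_INT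
    by (intro open_UN ballI open_vimage[OF _ continuous_on_coordinate]
        discrete_topology_class.open_discrete)
  finally show ?thesis by (rule borel_closed)
qed

lemma measurable_into_borel_Omega:
  assumes "continuous_on UNIV f" "\<And>x. x \<in> Omega d \<Longrightarrow> f x \<in> Omega d"
  shows "f \<in> borel_Omega d \<rightarrow>\<^sub>M borel_Omega d"
  unfolding borel_Omega_def
  by (rule measurable_restrict_space3) (use assms in \<open>auto intro: borel_measurable_continuous_onI\<close>)

lemma case_nat_in_Omega: "a \<in> {1..d} \<Longrightarrow> x \<in> Omega d \<Longrightarrow> case_nat a x \<in> Omega d"
  by (auto simp: Omega_def split: nat.split)

lemma upd_in_Omega: "a \<in> {1..d} \<Longrightarrow> x \<in> Omega d \<Longrightarrow> x(0 := a) \<in> Omega d"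
  by (auto simp: Omega_def)

lemma case_nat_upd_0: "(case_nat a x)(0 := j) = case_nat j x"
  by (auto simp: fun_eq_iff split: nat.split)

lemma measurable_case_nat:
  assumes "a \<in> {1..d}"
  shows "case_nat a \<in> borel_Omega d \<rightarrow>\<^sub>M borel_Omega d"
proof (rule measurable_into_borel_Omega)
  show "continuous_on UNIV (case_nat a :: point \<Rightarrow> point)"
  proof (rule continuous_on_coordinatewise_then_product)
    show "continuous_on UNIV (\<lambda>x::point. case_nat a x i)" for i
      by (cases i) (auto intro: continuous_on_coordinate)
  qed
qed (rule case_nat_in_Omega[OF assms])

lemma measurable_upd_0:
  assumes "a \<in> {1..d}"
  shows "(\<lambda>x. x(0 := a)) \<in> borel_Omega d \<rightarrow>\<^sub>M borel_Omega d"
proof (rule measurable_into_borel_Omega)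
  show "continuous_on UNIV (\<lambda>x::point. x(0 := a))"
  proof (rule continuous_on_coordinatewise_then_product)
    show "continuous_on UNIV (\<lambda>x::point. (x(0 := a)) i)" for i
      by (cases "i = 0") (auto intro: continuous_on_coordinate)
  qed
qed (rule upd_in_Omega[OF assms])

text \<open>
  The points that agree with \<open>x\<close> in the first \<open>k\<close> coordinates form an open neighbourhood of \<open>x\<close>, and
  \<open>\<phi>\<close> is constant there.
\<close>

lemma continuous_depends_on_first:
  assumes "depends_on_first d k \<phi>"
  shows "continuous_on (Omega d) \<phi>"
  unfolding continuous_on_def
proof
  fix x assume x: "x \<in> Omega d"
  have "open (\<Inter>n\<in>{..<k}. (\<lambda>y::point. y n) -` {x n})"
    by (intro open_INT finite_lessThan ballI open_vimage[OF _ continuous_on_coordinate]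
        discrete_topology_class.open_discrete)
  then have "\<forall>\<^sub>F y in at x within Omega d. y \<in> (\<Inter>n\<in>{..<k}. (\<lambda>y::point. y n) -` {x n})"
    by (intro topological_tendstoD[OF tendsto_ident_at]) auto
  moreover have "\<forall>\<^sub>F y in at x within Omega d. y \<in> Omega d"
    by (simp add: eventually_at_filter)
  ultimately have "\<forall>\<^sub>F y in at x within Omega d. \<phi> y = \<phi> x"
  proof eventually_elim
    case (elim y)
    then have "\<forall>n<k. y n = x n" by blast
    then show ?case using assms x elim(2) unfolding depends_on_first_def by blast
  qed
  then show "(\<phi> \<longlongrightarrow> \<phi> x) (at x within Omega d)"
    by (rule tendsto_eventually)
qed

lemma borel_measurable_continuous_Omega:
  "continuous_on (Omega d) f \<Longrightarrow> f \<in> borel_measurable (borel_Omega d)"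
  unfolding borel_Omega_def by (rule borel_measurable_continuous_on_restrict)

lemma continuous_bounded_Omega:
  assumes "continuous_on (Omega d) (f :: point \<Rightarrow> real)"
  obtains B where "\<And>x. x \<in> Omega d \<Longrightarrow> \<bar>f x\<bar> \<le> B"
proof -
  have "bounded (f ` Omega d)"
    by (intro compact_imp_bounded compact_continuous_image assms compact_Omega)
  then show ?thesis using that by (auto simp: bounded_iff)
qed

text \<open>
  Cylinders over finitely many coordinates are clopen because the coordinates are discrete, so their
  indicators are among the test functions. They form a generator of the Borel sets that is stable
  under intersection, on which finite measures may be compared. As the generator lives on the full
  product \<open>nat \<Rightarrow> nat\<close>, the measures are first pushed forward to it.
\<close>

lemma finite_measure_eqI_continuous:
  assumes M: "sets M = sets (borel_Omega d)" "finite_measure M"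
    and N: "sets N = sets (borel_Omega d)" "finite_measure N"
    and eq: "\<And>v :: point \<Rightarrow> real. continuous_on (Omega d) v \<Longrightarrow> (\<integral>x. v x \<partial>M) = (\<integral>x. v x \<partial>N)"
  shows "M = N"
proof -
  interpret M: finite_measure M by fact
  interpret N: finite_measure N by fact
  note [measurable_cong] = M(1) N(1)
  have [measurable]: "(\<lambda>x. x) \<in> borel_Omega d \<rightarrow>\<^sub>M borel"
    unfolding borel_Omega_def by (rule measurable_restrict_space1) simp
  have "distr M borel (\<lambda>x. x) = distr N borel (\<lambda>x. x)"
  proof (rule measure_eqI_PiM_infinite[where I = UNIV and M = "\<lambda>_. borel"])
    show "finite_measure (distr M borel (\<lambda>x. x))"
      by (rule M.finite_measure_distr) measurable
    show "sets (distr M borel (\<lambda>x. x)) = sets (Pi\<^sub>M UNIV (\<lambda>_. borel))"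
      by (simp add: sets_PiM_equal_borel)
    show "sets (distr N borel (\<lambda>x. x)) = sets (Pi\<^sub>M UNIV (\<lambda>_. borel))"
      by (simp add: sets_PiM_equal_borel)
    fix A :: "nat \<Rightarrow> nat set" and J :: "nat set"
    assume J: "finite J"
    let ?C = "prod_emb UNIV (\<lambda>_. borel) J (Pi\<^sub>E J A)"
    let ?v = "\<lambda>x::point. \<Prod>j\<in>J. indicator (A j) (x j) :: real"
    have C: "?C = {x. \<forall>j\<in>J. x j \<in> A j}"
      by (auto simp: prod_emb_def PiE_iff)
    have "?C \<in> sets (Pi\<^sub>M UNIV (\<lambda>_. borel :: nat measure))"
      by (rule sets_PiM_I[OF J subset_UNIV]) (simp add: sets_borel_eq_count_space)
    then have C_borel: "?C \<in> sets borel" by (simp add: sets_PiM_equal_borel)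
    have v: "continuous_on (Omega d) ?v"
      by (intro continuous_on_prod continuous_on_coordinate
          continuous_on_compose2[OF Topological_Spaces.continuous_on_discrete[of UNIV]]) auto
    have v_eq: "?v x = indicator ?C x" for x
      using J by (auto simp: C indicator_def prod_eq_1_iff)
    have C_Omega: "?C \<inter> Omega d \<in> sets (borel_Omega d)"
      using C_borel by (auto simp: borel_Omega_def sets_restrict_space)
    have "measure M (?C \<inter> Omega d) = (\<integral>x. ?v x \<partial>M)"
      by (simp add: v_eq space_eq_Omega[OF M(1)])
    also have "\<dots> = (\<integral>x. ?v x \<partial>N)" by (rule eq[OF v])
    also have "\<dots> = measure N (?C \<inter> Omega d)"
      by (simp add: v_eq space_eq_Omega[OF N(1)])
    finally show "emeasure (distr M borel (\<lambda>x. x)) ?C = emeasure (distr N borel (\<lambda>x. x)) ?C"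
      using C_borel by (simp add: emeasure_distr space_eq_Omega[OF M(1)] space_eq_Omega[OF N(1)]
          M.emeasure_eq_measure N.emeasure_eq_measure)
  qed
  \<comment> \<open>Borel sets of \<open>Omega d\<close> are Borel in the full product, so nothing is lost by the push-forward.\<close>
  then have *: "emeasure (distr M borel (\<lambda>x. x)) S = emeasure (distr N borel (\<lambda>x. x)) S" for S
    by simp
  show ?thesis
  proof (rule measure_eqI)
    fix S assume "S \<in> sets M"
    then have "S \<in> sets borel" "S \<subseteq> Omega d"
      using Omega_borel by (auto simp: M(1) borel_Omega_def sets_restrict_space)
    then show "emeasure M S = emeasure N S"
      using *[of S] by (simp add: emeasure_distr space_eq_Omega[OF M(1)] space_eq_Omega[OF N(1)]
          Int_absorb2)
  qed (simp add: M(1) N(1))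
qed

section \<open>The dual of the Ruelle operator on bounded Borel functions\<close>

text \<open>
  This is the candidate for the image of \<open>\<mu>\<close> under the dual of the Ruelle operator: choose a symbol \<open>a\<close>
  by counting and a tail \<open>x\<close> by \<open>\<mu>\<close>, weight the pair by \<open>exp (A(ax))\<close>, and move the mass to the sequence
  \<open>ax\<close>. A single push-forward from the product measure makes change of variables and Fubini
  available.
\<close>

definition ruelle_image :: "nat \<Rightarrow> (point \<Rightarrow> real) \<Rightarrow> point measure \<Rightarrow> point measure" where
  "ruelle_image d A \<mu> =
     distr (density (count_space {1..d} \<Otimes>\<^sub>M \<mu>)
              (\<lambda>p. ennreal (exp (A (case_nat (fst p) (snd p))))))
       (borel_Omega d) (\<lambda>p. case_nat (fst p) (snd p))"

context
  fixes d :: nat and A :: "point \<Rightarrow> real" and \<mu> :: "point measure"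
  assumes A: "continuous_on (Omega d) A" and sets_\<mu>: "sets \<mu> = sets (borel_Omega d)"
    and finite_\<mu>: "finite_measure \<mu>"
begin

interpretation \<mu>: finite_measure \<mu> by (rule finite_\<mu>)

interpretation branches: finite_measure "count_space {1..d}"
  by (rule finite_measure_count_space) simp

interpretation pair: finite_measure "count_space {1..d} \<Otimes>\<^sub>M \<mu>"
  by (rule finite_measure_pair_measure) unfold_locales

interpretation pair': pair_sigma_finite "count_space {1..d}" \<mu> ..

lemma measurable_branches:
  "(\<lambda>p. case_nat (fst p) (snd p)) \<in> (count_space {1..d} \<Otimes>\<^sub>M \<mu>) \<rightarrow>\<^sub>M borel_Omega d"
proof (rule measurable_pair_measure_countable1)
  fix a assume "a \<in> {1..d}"
  then show "(\<lambda>x. case_nat (fst (a, x)) (snd (a, x))) \<in> \<mu> \<rightarrow>\<^sub>M borel_Omega d"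
    using measurable_case_nat by (simp add: measurable_cong_sets[OF sets_\<mu> refl])
qed simp

lemma measurable_branch_weight:
  "(\<lambda>p. exp (A (case_nat (fst p) (snd p)))) \<in> borel_measurable (count_space {1..d} \<Otimes>\<^sub>M \<mu>)"
  by (rule measurable_compose[OF measurable_branches
        borel_measurable_continuous_Omega[OF continuous_on_exp[OF A]]])

lemma branch_in_Omega:
  "p \<in> space (count_space {1..d} \<Otimes>\<^sub>M \<mu>) \<Longrightarrow> case_nat (fst p) (snd p) \<in> Omega d"
  by (auto simp: space_pair_measure space_eq_Omega[OF sets_\<mu>] intro!: case_nat_in_Omega)

lemma finite_measure_ruelle_image: "finite_measure (ruelle_image d A \<mu>)"
proof -
  obtain B where B: "\<And>x. x \<in> Omega d \<Longrightarrow> \<bar>exp (A x)\<bar> \<le> B"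
    using continuous_bounded_Omega[OF continuous_on_exp[OF A]] by blast
  let ?P = "count_space {1..d} \<Otimes>\<^sub>M \<mu>"
  let ?w = "\<lambda>p. exp (A (case_nat (fst p) (snd p)))"
  have "integrable ?P ?w"
  proof (rule pair.integrable_const_bound[where B = B])
    show "AE p in ?P. norm (?w p) \<le> B"
      by (rule AE_I2) (use B[OF branch_in_Omega] in simp)
  qed (rule measurable_branch_weight)
  then have "(\<integral>\<^sup>+p. ennreal (?w p) \<partial>?P) < \<infinity>"
    by (subst nn_integral_eq_integral) auto
  moreover have "emeasure (density ?P (\<lambda>p. ennreal (?w p))) (space ?P) = (\<integral>\<^sup>+p. ennreal (?w p) \<partial>?P)"
    by (subst emeasure_density[OF _ sets.top])
      (use measurable_branch_weight in \<open>auto intro!: nn_integral_cong\<close>)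
  ultimately interpret D: finite_measure "density ?P (\<lambda>p. ennreal (?w p))"
    by (intro finite_measureI) (simp add: less_top)
  show ?thesis
    unfolding ruelle_image_def
    by (rule D.finite_measure_distr) (use measurable_branches in simp)
qed

text \<open>
  Change of variables, then the density, then Fubini; the inner integral over the counting measure on
  \<open>{1..d}\<close> is a finite sum. Compared with the duality for continuous functions, \<open>f\<close> may be any bounded
  Borel function with values in a Banach space.
\<close>

lemma integral_ruelle_image:
  fixes f :: "point \<Rightarrow> 'b::{banach, second_countable_topology}"
  assumes f: "f \<in> borel_measurable (borel_Omega d)" and B: "\<And>x. x \<in> Omega d \<Longrightarrow> norm (f x) \<le> B"
  shows "(\<integral>x. f x \<partial>ruelle_image d A \<mu>) =
         (\<integral>x. (\<Sum>a=1..d. exp (A (case_nat a x)) *\<^sub>R f (case_nat a x)) \<partial>\<mu>)"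
proof -
  let ?P = "count_space {1..d} \<Otimes>\<^sub>M \<mu>"
  let ?w = "\<lambda>p. exp (A (case_nat (fst p) (snd p)))"
  let ?f = "\<lambda>p. f (case_nat (fst p) (snd p))"
  note T = measurable_branches and w = measurable_branch_weight
  have f': "?f \<in> borel_measurable ?P"
    using measurable_compose[OF T f] .
  obtain C where C: "\<And>x. x \<in> Omega d \<Longrightarrow> \<bar>exp (A x)\<bar> \<le> C"
    using continuous_bounded_Omega[OF continuous_on_exp[OF A]] by blast
  have int: "integrable ?P (\<lambda>p. ?w p *\<^sub>R ?f p)"
  proof (rule pair.integrable_const_bound[where B = "C * B"])
    show "AE p in ?P. norm (?w p *\<^sub>R ?f p) \<le> C * B"
    proof (rule AE_I2)
      fix p assume "p \<in> space ?P"
      from C[OF branch_in_Omega[OF this]] B[OF branch_in_Omega[OF this]]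
      show "norm (?w p *\<^sub>R ?f p) \<le> C * B"
        unfolding norm_scaleR by (intro mult_mono) (auto intro: order_trans[OF exp_ge_zero])
    qed
  qed (use w f' in simp)
  have "(\<integral>x. f x \<partial>ruelle_image d A \<mu>) = (\<integral>p. ?f p \<partial>density ?P (\<lambda>p. ennreal (?w p)))"
    unfolding ruelle_image_def
    by (rule integral_distr) (use T f in auto)
  also have "\<dots> = (\<integral>p. ?w p *\<^sub>R ?f p \<partial>?P)"
    by (rule integral_density) (use w f' in auto)
  also have "\<dots> = (\<integral>x. (\<integral>a. exp (A (case_nat a x)) *\<^sub>R f (case_nat a x) \<partial>count_space {1..d}) \<partial>\<mu>)"
    using pair'.integral_snd[of "\<lambda>a x. exp (A (case_nat a x)) *\<^sub>R f (case_nat a x)"] int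
    by (simp add: case_prod_unfold)
  finally show ?thesis
    by (simp add: lebesgue_integral_count_space_finite)
qed

lemma ruelle_dual_imp_eq_ruelle_image:
  assumes "ruelle_dual d A \<mu> \<rho>"
  shows "\<rho> = ruelle_image d A \<mu>"
proof (rule finite_measure_eqI_continuous)
  fix v :: "point \<Rightarrow> real" assume v: "continuous_on (Omega d) v"
  obtain B where "\<And>x. x \<in> Omega d \<Longrightarrow> \<bar>v x\<bar> \<le> B"
    using continuous_bounded_Omega[OF v] by blast
  then have "(\<integral>x. v x \<partial>ruelle_image d A \<mu>) = (\<integral>x. ruelle d A v x \<partial>\<mu>)"
    using integral_ruelle_image[OF borel_measurable_continuous_Omega[OF v], of B]
    by (simp add: ruelle_def)
  then show "(\<integral>x. v x \<partial>\<rho>) = (\<integral>x. v x \<partial>ruelle_image d A \<mu>)"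
    using assms v by (simp add: ruelle_dual_def)
qed (use assms finite_measure_ruelle_image in \<open>auto simp: ruelle_dual_def ruelle_image_def\<close>)

text \<open>
  The eigenmeasure equation beyond continuous functions: \<open>r\<mu>\<close> is the measure constructed above, so it
  inherits the integral formula for bounded Borel functions.
\<close>

lemma eigenmeasure_integral:
  fixes f :: "point \<Rightarrow> 'b::{banach, second_countable_topology}"
  assumes "ruelle_dual d A \<mu> (scale_measure (ennreal r) \<mu>)" "r > 0"
    and f: "f \<in> borel_measurable (borel_Omega d)" and B: "\<And>x. x \<in> Omega d \<Longrightarrow> norm (f x) \<le> B"
  shows "r *\<^sub>R (\<integral>x. f x \<partial>\<mu>) =
         (\<integral>x. (\<Sum>a=1..d. exp (A (case_nat a x)) *\<^sub>R f (case_nat a x)) \<partial>\<mu>)"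
proof -
  have f': "f \<in> borel_measurable \<mu>"
    using f by (simp add: measurable_cong_sets[OF sets_\<mu> refl])
  \<comment> \<open>Scaling is a constant density, for which the change of variables for integrals is available.\<close>
  have "scale_measure (ennreal r) \<mu> = density \<mu> (\<lambda>_. ennreal r)"
    by (rule measure_eqI) (auto simp: emeasure_density_const)
  then have "(\<integral>x. f x \<partial>scale_measure (ennreal r) \<mu>) = r *\<^sub>R (\<integral>x. f x \<partial>\<mu>)"
    using f' \<open>r > 0\<close> by (simp add: integral_density)
  then show ?thesis
    using integral_ruelle_image[OF f B] ruelle_dual_imp_eq_ruelle_image[OF assms(1)] by simp
qed

end

section \<open>Functions on the groupoid\<close>

lemma in_groupoid_iff: "(x, y) \<in> groupoid d \<longleftrightarrow> x \<in> Omega d \<and> y \<in> class_of d x"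
  by (auto simp: groupoid_def class_of_def)

lemma class_of_eq:
  assumes "x \<in> Omega d"
  shows "class_of d x = (\<lambda>j. x(0 := j)) ` {1..d}"
proof -
  have "y \<in> (\<lambda>j. x(0 := j)) ` {1..d}" if "y \<in> class_of d x" for y
  proof (rule image_eqI)
    show "y = x(0 := y 0)" "y 0 \<in> {1..d}"
      using that by (auto simp: class_of_def bigger_than_two_def Omega_def fun_eq_iff)
  qed
  then show ?thesis
    using upd_in_Omega[OF _ assms] by (auto simp: class_of_def bigger_than_two_def)
qed

lemma integral_nu:
  fixes g :: "point \<Rightarrow> 'b::{banach, second_countable_topology}"
  assumes "x \<in> Omega d"
  shows "(\<integral>s. g s \<partial>nu d x) = (\<Sum>j=1..d. g (x(0 := j)))"
proof -
  have "inj_on (\<lambda>j. x(0 := j)) {1..d}"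
    by (metis fun_upd_same inj_onI)
  then show ?thesis
    by (simp add: nu_def class_of_eq[OF assms] lebesgue_integral_count_space_finite sum.reindex)
qed

text \<open>
  The value \<open>|h(x, y)|\<close> is one term of the sum of \<open>|h(x, s)|\<close> over the class of \<open>x\<close>, and the supremum of
  these sums over \<open>x\<close> is finite.
\<close>

lemma I_space_bounded:
  assumes "h \<in> I_space d"
  obtains B where "\<And>x y. (x, y) \<in> groupoid d \<Longrightarrow> norm (h (x, y)) \<le> B"
proof -
  let ?S = "SUP y\<in>Omega d. \<integral>\<^sup>+ x. ennreal (norm (h (y, x))) \<partial>nu d y"
  have "?S < \<infinity>" using assms by (simp add: I_space_def)
  then obtain B where B: "?S = ennreal B" "0 \<le> B" by (cases ?S) auto
  have "norm (h (x, y)) \<le> B" if "(x, y) \<in> groupoid d" for x y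
  proof -
    have x: "x \<in> Omega d" and y: "y \<in> class_of d x" using that by (auto simp: in_groupoid_iff)
    have fin: "finite (class_of d x)" by (simp add: class_of_eq[OF x])
    have "ennreal (norm (h (x, y))) \<le> (\<Sum>s\<in>class_of d x. ennreal (norm (h (x, s))))"
      by (rule member_le_sum) (use y fin in auto)
    also have "\<dots> = (\<integral>\<^sup>+ s. ennreal (norm (h (x, s))) \<partial>nu d x)"
      by (simp add: nu_def nn_integral_count_space_finite fin)
    also have "\<dots> \<le> ?S" by (rule SUP_upper[OF x])
    finally show ?thesis using B by simp
  qed
  then show ?thesis by (rule that)
qed

lemma measurable_into_groupoid:
  assumes "f \<in> borel_Omega d \<rightarrow>\<^sub>M borel_Omega d" "g \<in> borel_Omega d \<rightarrow>\<^sub>M borel_Omega d"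
    and "\<And>x. x \<in> Omega d \<Longrightarrow> (f x, g x) \<in> groupoid d"
  shows "(\<lambda>x. (f x, g x)) \<in> borel_Omega d \<rightarrow>\<^sub>M restrict_space borel (groupoid d)"
proof (rule measurable_restrict_space2)
  have *: "u \<in> borel_Omega d \<rightarrow>\<^sub>M borel" if "u \<in> borel_Omega d \<rightarrow>\<^sub>M borel_Omega d" for u
    using that unfolding borel_Omega_def by (simp add: measurable_restrict_space2_iff)
  show "(\<lambda>x. (f x, g x)) \<in> borel_measurable (borel_Omega d)"
    by (intro borel_measurable_Pair * assms)
qed (use assms(3) in \<open>auto simp: space_borel_Omega\<close>)

lemma groupoid_upd:
  assumes "x \<in> Omega d" "j \<in> {1..d}"
  shows "(x(0 := j), x) \<in> groupoid d" "(x, x(0 := j)) \<in> groupoid d"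
  using assms upd_in_Omega[OF assms(2,1)] by (auto simp: groupoid_def bigger_than_two_def)

text \<open>
  The measurability of \<open>h\<close> refers only to the \<open>\<sigma>\<close>-algebra on the groupoid, so \<open>h\<close> has to be composed with
  measurable maps into the groupoid.
\<close>

lemma I_space_measurable_upd:
  assumes "h \<in> I_space d" "j \<in> {1..d}"
  shows "(\<lambda>x. h (x(0 := j), x)) \<in> borel_measurable (borel_Omega d)"
    and "(\<lambda>x. h (x, x(0 := j))) \<in> borel_measurable (borel_Omega d)"
  using assms
  by (auto simp: I_space_def simp del: fun_upd_apply
      intro!: measurable_compose[OF measurable_into_groupoid] measurable_upd_0 groupoid_upd)

section \<open>Eigenmeasures are KMS\<close>

text \<open>
  The two sides of the KMS identity, with the integrals over classes written as sums. Applying the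
  eigenmeasure equation to both turns them into integrals of the same double sum over the points
  \<open>1x, ..., dx\<close> of a class.
\<close>

lemma eigenmeasure_exchange:
  fixes A :: "point \<Rightarrow> real"
  assumes A: "continuous_on (Omega d) A" and \<mu>: "borel_probability d \<mu>"
    and r: "r > 0" and eigen: "ruelle_dual d A \<mu> (scale_measure (ennreal r) \<mu>)"
    and h: "h \<in> I_space d"
  defines "F \<equiv> \<lambda>x. \<Sum>j=1..d. h (x(0 := j), x)"
    and "H \<equiv> \<lambda>x. \<Sum>j=1..d. h (x, x(0 := j)) * complex_of_real (exp (A (x(0 := j)) - A x))"
  shows "integrable \<mu> F" and "integrable \<mu> H" and "(\<integral>x. F x \<partial>\<mu>) = (\<integral>x. H x \<partial>\<mu>)"
proof -
  have sets_\<mu>: "sets \<mu> = sets (borel_Omega d)" and "prob_space \<mu>"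
    using \<mu> by (auto simp: borel_probability_def)
  then interpret prob_space \<mu> by simp
  obtain B where B: "\<And>x y. (x, y) \<in> groupoid d \<Longrightarrow> norm (h (x, y)) \<le> B"
    using I_space_bounded[OF h] by blast
  obtain C where C: "\<And>x. x \<in> Omega d \<Longrightarrow> \<bar>A x\<bar> \<le> C"
    using continuous_bounded_Omega[OF A] by blast
  note mA = borel_measurable_continuous_Omega[OF A]
  have F_bound: "norm (F x) \<le> (\<Sum>j=1..d. B)" if "x \<in> Omega d" for x
    unfolding F_def by (intro sum_norm_le B groupoid_upd that)
  have H_bound: "norm (H x) \<le> (\<Sum>j=1..d. B * exp (2 * C))" if x: "x \<in> Omega d" for x
    unfolding H_def
  proof (rule sum_norm_le)
    fix j assume j: "j \<in> {1..d}"
    have "norm (h (x, x(0 := j))) \<le> B" by (intro B groupoid_upd x j)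
    moreover have "A (x(0 := j)) - A x \<le> 2 * C"
      using C[OF x] C[OF upd_in_Omega[OF j x]] by linarith
    moreover have "0 \<le> B" using calculation(1) norm_ge_zero order_trans by blast
    ultimately show "norm (h (x, x(0 := j)) * complex_of_real (exp (A (x(0 := j)) - A x)))
        \<le> B * exp (2 * C)"
      unfolding norm_mult norm_of_real abs_exp_cancel by (intro mult_mono) auto
  qed
  have F_meas: "F \<in> borel_measurable (borel_Omega d)"
    unfolding F_def by (intro borel_measurable_sum I_space_measurable_upd h)
  have weight_meas: "(\<lambda>x. complex_of_real (exp (A (x(0 := j)) - A x))) \<in> borel_measurable (borel_Omega d)"
    if "j \<in> {1..d}" for j
  proof -
    note [measurable] = mA measurable_compose[OF measurable_upd_0[OF that] mA]
    show ?thesis by measurable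
  qed
  have H_meas: "H \<in> borel_measurable (borel_Omega d)"
    unfolding H_def
    by (intro borel_measurable_sum borel_measurable_times I_space_measurable_upd h weight_meas)
  show "integrable \<mu> F"
    by (rule integrable_const_bound[where B = "\<Sum>j=1..d. B"])
      (use F_bound F_meas in \<open>auto simp: space_eq_Omega[OF sets_\<mu>] measurable_cong_sets[OF sets_\<mu> refl]\<close>)
  show "integrable \<mu> H"
    by (rule integrable_const_bound[where B = "\<Sum>j=1..d. B * exp (2 * C)"])
      (use H_bound H_meas in \<open>auto simp: space_eq_Omega[OF sets_\<mu>] measurable_cong_sets[OF sets_\<mu> refl]\<close>)
  \<comment> \<open>Renaming the summation indices: the weight \<open>exp (- A(ax))\<close> in \<open>H\<close> cancels the weight of the operator.\<close>
  have swap: "(\<Sum>a=1..d. exp (A (case_nat a x)) *\<^sub>R F (case_nat a x)) =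
      (\<Sum>a=1..d. exp (A (case_nat a x)) *\<^sub>R H (case_nat a x))" for x
  proof -
    have "(\<Sum>a=1..d. exp (A (case_nat a x)) *\<^sub>R F (case_nat a x)) =
        (\<Sum>a=1..d. \<Sum>j=1..d. exp (A (case_nat a x)) *\<^sub>R h (case_nat j x, case_nat a x))"
      by (simp add: F_def case_nat_upd_0 scaleR_sum_right)
    also have "\<dots> = (\<Sum>j=1..d. \<Sum>a=1..d. exp (A (case_nat a x)) *\<^sub>R h (case_nat j x, case_nat a x))"
      by (rule sum.swap)
    also have "\<dots> = (\<Sum>j=1..d. exp (A (case_nat j x)) *\<^sub>R H (case_nat j x))"
    proof (rule sum.cong[OF refl])
      fix j assume "j \<in> {1..d}"
      have "exp (A (case_nat a x)) *\<^sub>R h (case_nat j x, case_nat a x) =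
          exp (A (case_nat j x)) *\<^sub>R (h (case_nat j x, case_nat a x) *
            complex_of_real (exp (A (case_nat a x) - A (case_nat j x))))" for a
      proof -
        have "exp (A (case_nat a x)) = exp (A (case_nat j x)) * exp (A (case_nat a x) - A (case_nat j x))"
          by (simp flip: exp_add)
        then show ?thesis
          by (simp only: scaleR_conv_of_real of_real_mult mult_ac)
      qed
      then show "(\<Sum>a=1..d. exp (A (case_nat a x)) *\<^sub>R h (case_nat j x, case_nat a x)) =
          exp (A (case_nat j x)) *\<^sub>R H (case_nat j x)"
        by (simp only: H_def case_nat_upd_0 scaleR_sum_right)
    qed
    finally show ?thesis .
  qed
  note eigen_eq = eigenmeasure_integral[OF A sets_\<mu> finite_measure_axioms eigen r]
  have "r *\<^sub>R (\<integral>x. F x \<partial>\<mu>) = r *\<^sub>R (\<integral>x. H x \<partial>\<mu>)"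
    using eigen_eq[OF F_meas F_bound] eigen_eq[OF H_meas H_bound] by (simp only: swap)
  then show "(\<integral>x. F x \<partial>\<mu>) = (\<integral>x. H x \<partial>\<mu>)" using r by simp
qed

text \<open>
  With \<open>A = - \<beta> \<phi>\<close> the weight \<open>exp (A(s) - A(x))\<close> is \<open>exp (- \<beta> c(x, s))\<close> for \<open>c(x, s) = \<phi>(s) - \<phi>(x)\<close>.
  It remains to identify the integrals over classes with sums over the first coordinate.
\<close>

lemma eigenmeasure_KMS:
  fixes \<phi> :: "point \<Rightarrow> real"
  assumes \<phi>: "continuous_on (Omega d) \<phi>" and \<mu>: "borel_probability d \<mu>"
    and r: "r > 0" and eigen: "ruelle_dual d (\<lambda>x. - \<beta> * \<phi> x) \<mu> (scale_measure (ennreal r) \<mu>)"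
  shows "KMS d (\<lambda>(x, y). \<phi> y - \<phi> x) \<beta> \<mu>"
proof -
  have A: "continuous_on (Omega d) (\<lambda>x. - \<beta> * \<phi> x)"
    by (intro continuous_intros \<phi>)
  have space: "space \<mu> = Omega d"
    using \<mu> by (simp add: borel_probability_def space_eq_Omega)
  let ?L = "\<lambda>h x. \<integral>s. h (s, x) \<partial>nu d x"
  let ?R = "\<lambda>h x. \<integral>s. h (x, s) * complex_of_real (exp (- \<beta> * (\<phi> s - \<phi> x))) \<partial>nu d x"
  have "integrable \<mu> (?L h) \<and> integrable \<mu> (?R h) \<and> (\<integral>x. ?L h x \<partial>\<mu>) = (\<integral>x. ?R h x \<partial>\<mu>)"
    if h: "h \<in> I_space d" for h
  proof -
    have L: "?L h x = (\<Sum>j=1..d. h (x(0 := j), x))" if "x \<in> space \<mu>" for x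
      using that by (simp add: integral_nu space)
    have R: "?R h x = (\<Sum>j=1..d. h (x, x(0 := j)) *
        complex_of_real (exp (- \<beta> * \<phi> (x(0 := j)) - - \<beta> * \<phi> x)))" if "x \<in> space \<mu>" for x
      using that by (subst integral_nu) (simp_all add: space right_diff_distrib algebra_simps)
    show ?thesis
    proof (intro conjI)
      show "integrable \<mu> (?L h)"
        by (rule iffD2[OF Bochner_Integration.integrable_cong[OF refl L]
              eigenmeasure_exchange(1)[OF A \<mu> r eigen h]])
      show "integrable \<mu> (?R h)"
        by (rule iffD2[OF Bochner_Integration.integrable_cong[OF refl R]
              eigenmeasure_exchange(2)[OF A \<mu> r eigen h]])
      have "(\<integral>x. ?L h x \<partial>\<mu>) = (\<integral>x. (\<Sum>j=1..d. h (x(0 := j), x)) \<partial>\<mu>)"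
        by (rule Bochner_Integration.integral_cong[OF refl L])
      also note eigenmeasure_exchange(3)[OF A \<mu> r eigen h]
      also have "(\<integral>x. (\<Sum>j=1..d. h (x, x(0 := j)) *
          complex_of_real (exp (- \<beta> * \<phi> (x(0 := j)) - - \<beta> * \<phi> x))) \<partial>\<mu>) = (\<integral>x. ?R h x \<partial>\<mu>)"
        by (rule Bochner_Integration.integral_cong[OF refl R, symmetric])
      finally show "(\<integral>x. ?L h x \<partial>\<mu>) = (\<integral>x. ?R h x \<partial>\<mu>)" .
    qed
  qed
  then show ?thesis
    using \<mu> by (simp add: KMS_def cocycle_def)
qed

theorem theorem54:
  fixes d k :: nat and \<phi> :: "point \<Rightarrow> real"
  assumes "d \<ge> 1" and "k \<ge> 1" and "depends_on_first d k \<phi>"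
  shows "(\<forall>\<mu> r. borel_probability d \<mu> \<and> r > 0 \<and>
            ruelle_dual d (\<lambda>x. - \<phi> x) \<mu> (scale_measure (ennreal r) \<mu>) \<longrightarrow>
            KMS d (\<lambda>(x, y). \<phi> y - \<phi> x) 1 \<mu> \<and>
            (\<forall>h\<in>I_space d.
               (\<integral>x. (\<Sum>j=1..d. h (x(0 := j), x)) \<partial>\<mu>) =
               (\<integral>x. (\<Sum>j=1..d. h (x, x(0 := j)) *
                        complex_of_real (exp (- \<phi> (x(0 := j)) + \<phi> x))) \<partial>\<mu>)))
       \<and> (\<forall>\<beta>>0. \<forall>\<mu> r. borel_probability d \<mu> \<and> r > 0 \<and>
            ruelle_dual d (\<lambda>x. - \<beta> * \<phi> x) \<mu> (scale_measure (ennreal r) \<mu>) \<longrightarrow>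
            KMS d (\<lambda>(x, y). \<phi> y - \<phi> x) \<beta> \<mu>)"
proof -
  note \<phi> = continuous_depends_on_first[OF assms(3)]
  have "(\<integral>x. (\<Sum>j=1..d. h (x(0 := j), x)) \<partial>\<mu>) =
      (\<integral>x. (\<Sum>j=1..d. h (x, x(0 := j)) * complex_of_real (exp (- \<phi> (x(0 := j)) + \<phi> x))) \<partial>\<mu>)"
    if "borel_probability d \<mu>" "r > 0"
      "ruelle_dual d (\<lambda>x. - \<phi> x) \<mu> (scale_measure (ennreal r) \<mu>)" "h \<in> I_space d" for \<mu> r h
    using eigenmeasure_exchange(3)[OF continuous_on_minus[OF \<phi>] that] by simp
  moreover have "KMS d (\<lambda>(x, y). \<phi> y - \<phi> x) 1 \<mu>"
    if "borel_probability d \<mu>" "r > 0"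
      "ruelle_dual d (\<lambda>x. - \<phi> x) \<mu> (scale_measure (ennreal r) \<mu>)" for \<mu> r
    using eigenmeasure_KMS[OF \<phi> that(1,2), of 1] that(3) by simp
  ultimately show ?thesis
    using eigenmeasure_KMS[OF \<phi>] by blast
qed

end
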